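(* Let $C_1$ be an admissible kernel (as defined in the context), with Lipschitz function $\mu_1$. Let $f\in AA(\mathbb{R}\times\mathbb{X}\times\mathbb{X};\mathbb{X})$ be $L_f$-Lipschitz, that is, $$\|f(t,x,y)-f(t,x_1,y_1)\|\le L_f\big(\|x-x_1\|+\|y-y_1\|\big)$$ for $t\in\mathbb{R}$ and $(x,y),(x_1,y_1)$ in bounded subsets of $\mathbb{X}\times\mathbb{X}$. Suppose that $$L_f+\sup_{t\in\mathbb{R}}\int_{-\infty}^t\mu_1(t,s)\,ds=\rho<1,$$ and that $h_0,h_1\in AA(\mathbb{R};\mathbb{R})$. Then a bounded solution $y:\mathbb{R}\to\mathbb{X}$ of the integral equation $$y(t)=f(t,y(t),y(h_0(t)))+\int_{-\infty}^{t}C_1(t,s,y(s),y(h_1(s)))\,ds,\quad t\in\mathbb{R},$$ is almost automorphic if and only if it has relatively compact range.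
   Context: $\mathbb{X}$ is a Banach space. $AA(\mathbb{R};\mathbb{Z})$ (almost automorphic functions into a Banach space $\mathbb{Z}$): bounded continuous $f:\mathbb{R}\to\mathbb{Z}$ such that every real sequence $(s_n')$ has a subsequence $(s_n)$ and there is a function $\tilde f$ with $\lim_n f(t+s_n)=\tilde f(t)$ and $\lim_n\tilde f(t-s_n)=f(t)$ for each $t\in\mathbb{R}$. $AA(\mathbb{R}\times\mathbb{Y};\mathbb{X})$ ($\mathbb{Y}$ a Banach space): bounded continuous $f:\mathbb{R}\times\mathbb{Y}\to\mathbb{X}$ such that for every bounded $\mathcal{B}\subset\mathbb{Y}$ and every real sequence $(s_n')$ there are a subsequence $(s_n)$ and a function $\tilde f$ with $\lim_n f(t+s_n,x)=\tilde f(t,x)$ and $\lim_n\tilde f(t-s_n,x)=f(t,x)$, pointwise in $t\in\mathbb{R}$ and uniformly for $x\in\mathcal{B}$. Bi-almost automorphic: a jointly continuous $C:\mathbb{R}\times\mathbb{R}\times\mathbb{X}\times\mathbb{X}\to\mathbb{X}$ such that for every real sequence and every bounded $\mathcal{B}\subset\mathbb{X}\times\mathbb{X}$ there is a subsequence $(s_n)$ with $\tilde C(t,s,x,y):=\lim_n C(t+s_n,s+s_n,x,y)$ existing and $\lim_n\tilde C(t-s_n,s-s_n,x,y)=C(t,s,x,y)$, for each $(t,s)\in\mathbb{R}^2$ and uniformly for $(x,y)\in\mathcal{B}$. Such $\tilde C$ are called limit functions of $C$. $\lambda$-bounded: there is a positive function $\lambda:\mathbb{R}\times\mathbb{R}\to\mathbb{R}$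 such that $\|C(t+\tau,s+\tau,x,y)\|\le\lambda(t,s)$ for all $t,s,\tau\in\mathbb{R}$, uniformly for $(x,y)$ in bounded subsets of $\mathbb{X}\times\mathbb{X}$ (the same $\lambda$ for all bounded subsets). $(\mu,\tilde\mu)$-Lipschitz: there are functions $\mu,\tilde\mu:\mathbb{R}\times\mathbb{R}\to[0,\infty)$ such that, for $(u_1,u_2),(v_1,v_2)$ in bounded subsets of $\mathbb{X}\times\mathbb{X}$, $\|C(t,s,u_1,u_2)-C(t,s,v_1,v_2)\|\le\mu(t,s)(\|u_1-v_1\|+\|u_2-v_2\|)$, and the same holds with $\tilde C$ (the limit functions), $\tilde\mu$ in place of $C,\mu$. Admissible kernel: $C_1:\mathbb{R}\times\mathbb{R}\times\mathbb{X}\times\mathbb{X}\to\mathbb{X}$ is Bi-almost automorphic, $\lambda_1$-bounded and $(\mu_1,\tilde\mu_1)$-Lipschitz, with $\sup_t\int_{-\infty}^t\lambda_1(t,s)ds<\infty$ and $\sup_t\int_{-\infty}^t\mu_1(t,s)ds<\infty$.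
   Formalization: Solutions y are assumed continuous; otherwise the claim fails: X=ℝ, C₁=0, h₀(t)=2 sin t, f(t,x,z)=0.6(x+z) truncated to [-1,1] has the bounded solution y=sgn(sin t), with finite range but discontinuous, hence not almost automorphic. *)

theory Defs
  imports "HOL-Analysis.Analysis"
begin

definition almost_automorphic :: "(real \<Rightarrow> 'z::banach) \<Rightarrow> bool" where
  "almost_automorphic f \<longleftrightarrow>
     bounded (range f) \<and> continuous_on UNIV f \<and>
     (\<forall>\<sigma> :: nat \<Rightarrow> real. \<exists>r g. strict_mono r \<and>
        (\<forall>t. (\<lambda>n. f (t + \<sigma> (r n))) \<longlonglongrightarrow> g t) \<and>
        (\<forall>t. (\<lambda>n. g (t - \<sigma> (r n))) \<longlonglongrightarrow> f t))"

text \<open>The functions of class \<open>AA(\<real> \<times> Y; X)\<close>. Boundedness is global on \<open>\<real> \<times> Y\<close>;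
  the limit function \<open>g\<close> may depend on the bounded set \<open>B\<close>, and only its values on \<open>B\<close> matter.\<close>

definition almost_automorphic_unif :: "(real \<Rightarrow> 'y::banach \<Rightarrow> 'x::banach) \<Rightarrow> bool" where
  "almost_automorphic_unif f \<longleftrightarrow>
     bounded (range (\<lambda>(t, x). f t x)) \<and> continuous_on UNIV (\<lambda>(t, x). f t x) \<and>
     (\<forall>B. bounded B \<longrightarrow>
       (\<forall>\<sigma> :: nat \<Rightarrow> real. \<exists>r g. strict_mono r \<and>
          (\<forall>t. uniform_limit B (\<lambda>n x. f (t + \<sigma> (r n)) x) (\<lambda>x. g t x) sequentially) \<and>
          (\<forall>t. uniform_limit B (\<lambda>n x. g (t - \<sigma> (r n)) x) (\<lambda>x. f t x) sequentially)))"

text \<open>\<open>D\<close> is a limit function of \<open>C\<close> on \<open>B\<close>, obtained along the sequence \<open>\<sigma>\<close>.\<close>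

definition limit_function_along ::
    "(real \<Rightarrow> real \<Rightarrow> 'x::banach \<Rightarrow> 'x \<Rightarrow> 'x) \<Rightarrow> ('x \<times> 'x) set \<Rightarrow> (nat \<Rightarrow> real) \<Rightarrow>
     (real \<Rightarrow> real \<Rightarrow> 'x \<Rightarrow> 'x \<Rightarrow> 'x) \<Rightarrow> bool" where
  "limit_function_along C B \<sigma> D \<longleftrightarrow>
     (\<forall>t s. uniform_limit B (\<lambda>n (x, y). C (t + \<sigma> n) (s + \<sigma> n) x y)
              (\<lambda>(x, y). D t s x y) sequentially) \<and>
     (\<forall>t s. uniform_limit B (\<lambda>n (x, y). D (t - \<sigma> n) (s - \<sigma> n) x y)
              (\<lambda>(x, y). C t s x y) sequentially)"

definition bi_almost_automorphic ::
    "(real \<Rightarrow> real \<Rightarrow> 'x::banach \<Rightarrow> 'x \<Rightarrow> 'x) \<Rightarrow> bool" where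
  "bi_almost_automorphic C \<longleftrightarrow>
     continuous_on UNIV (\<lambda>(t, s, x, y). C t s x y) \<and>
     (\<forall>\<sigma> :: nat \<Rightarrow> real. \<forall>B. bounded B \<longrightarrow>
        (\<exists>r D. strict_mono r \<and> limit_function_along C B (\<lambda>n. \<sigma> (r n)) D))"

definition lambda_bounded ::
    "(real \<Rightarrow> real \<Rightarrow> real) \<Rightarrow> (real \<Rightarrow> real \<Rightarrow> 'x::banach \<Rightarrow> 'x \<Rightarrow> 'x) \<Rightarrow> bool" where
  "lambda_bounded l C \<longleftrightarrow>
     (\<forall>t s. 0 < l t s) \<and>
     (\<forall>B. bounded B \<longrightarrow>
        (\<forall>(x, y)\<in>B. \<forall>t s \<tau>. norm (C (t + \<tau>) (s + \<tau>) x y) \<le> l t s))"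

text \<open>The single function \<open>m'\<close> serves all limit functions of \<open>C\<close>, whatever the sequence and
  the bounded set.\<close>

definition kernel_lipschitz ::
    "(real \<Rightarrow> real \<Rightarrow> real) \<Rightarrow> (real \<Rightarrow> real \<Rightarrow> real) \<Rightarrow>
     (real \<Rightarrow> real \<Rightarrow> 'x::banach \<Rightarrow> 'x \<Rightarrow> 'x) \<Rightarrow> bool" where
  "kernel_lipschitz m m' C \<longleftrightarrow>
     (\<forall>t s. 0 \<le> m t s) \<and> (\<forall>t s. 0 \<le> m' t s) \<and>
     (\<forall>B. bounded B \<longrightarrow>
        (\<forall>(u1, u2)\<in>B. \<forall>(v1, v2)\<in>B. \<forall>t s.
           norm (C t s u1 u2 - C t s v1 v2) \<le> m t s * (norm (u1 - v1) + norm (u2 - v2))) \<and>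
        (\<forall>\<sigma> D. limit_function_along C B \<sigma> D \<longrightarrow>
           (\<forall>(u1, u2)\<in>B. \<forall>(v1, v2)\<in>B. \<forall>t s.
              norm (D t s u1 u2 - D t s v1 v2) \<le> m' t s * (norm (u1 - v1) + norm (u2 - v2)))))"

text \<open>Finiteness of \<open>sup\<^sub>t \<integral>\<^bsub>-\<infinity>\<^esub>\<^bsup>t\<^esup> k t s ds\<close>. The integral is the Henstock-Kurzweil one, which on the
  nonnegative \<open>k\<close> considered here is the Lebesgue integral.\<close>

definition sup_integral_finite :: "(real \<Rightarrow> real \<Rightarrow> real) \<Rightarrow> bool" where
  "sup_integral_finite k \<longleftrightarrow>
     (\<forall>t. k t integrable_on {..t}) \<and> bdd_above (range (\<lambda>t. integral {..t} (k t)))"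

definition admissible_kernel ::
    "(real \<Rightarrow> real \<Rightarrow> 'x::banach \<Rightarrow> 'x \<Rightarrow> 'x) \<Rightarrow> (real \<Rightarrow> real \<Rightarrow> real) \<Rightarrow>
     (real \<Rightarrow> real \<Rightarrow> real) \<Rightarrow> (real \<Rightarrow> real \<Rightarrow> real) \<Rightarrow> bool" where
  "admissible_kernel C l m m' \<longleftrightarrow>
     bi_almost_automorphic C \<and> lambda_bounded l C \<and> kernel_lipschitz m m' C \<and>
     sup_integral_finite l \<and> sup_integral_finite m"

text \<open>Solutions are continuous functions, as usual for an integral equation; this is not implied
  by the equation itself: the (truncated) equation \<open>y t = max (-1) (min 1 (3/5 * (y t + y (2 * sin t))))\<close>
  has the bounded discontinuous solution \<open>\<lambda>t. sgn (sin t)\<close>.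
  The Henstock-Kurzweil integral is used because the library's Bochner integral is available for
  separable spaces only. For an admissible kernel and a bounded continuous \<open>y\<close>, the integrand is
  continuous in \<open>s\<close> and dominated in norm by an integrable function, so the two notions agree.\<close>

definition integral_equation_solution ::
    "(real \<Rightarrow> 'x::banach \<times> 'x \<Rightarrow> 'x) \<Rightarrow> (real \<Rightarrow> real \<Rightarrow> 'x \<Rightarrow> 'x \<Rightarrow> 'x) \<Rightarrow>
     (real \<Rightarrow> real) \<Rightarrow> (real \<Rightarrow> real) \<Rightarrow> (real \<Rightarrow> 'x) \<Rightarrow> bool" where
  "integral_equation_solution f C h0 h1 y \<longleftrightarrow>
     continuous_on UNIV y \<and>
     (\<forall>t. (\<lambda>s. C t s (y s) (y (h1 s))) integrable_on {..t} \<and>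
          y t = f t (y t, y (h0 t)) + integral {..t} (\<lambda>s. C t s (y s) (y (h1 s))))"

end

theory Submission
  imports Defs
begin

text \<open>A continuous \<open>y\<close> makes \<open>y \<circ> h0\<close> and \<open>y \<circ> h1\<close> almost automorphic, whatever \<open>y\<close> is. So the equation
  is a contraction with constant \<open>\<rho>\<close> in the undelayed \<open>y\<close>, with almost automorphic data. Along a sequence on
  which all the data converge, the quantity \<open>a t = limsup \<parallel>y (t + \<sigma> p) - y (t + \<sigma> q)\<parallel>\<close>
  satisfies, by the reverse Fatou lemma,
  \<open>a t \<le> Lf * a t + K * sup a\<close> with \<open>Lf + K = \<rho>\<close>; hence \<open>a = 0\<close> and the translates converge pointwise.
  The same estimate shows that translating the limit back gives \<open>y\<close>.
  Conversely, almost automorphy makes every sequence \<open>y (0 + \<tau> n)\<close> subconvergent.\<close>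

section \<open>Integration over half-lines: translation and reverse Fatou\<close>

text \<open>\<open>has_integral_alt'\<close> describes the half-line integral through boxes around a
  large ball, and each box can be translated.\<close>

lemma has_integral_atMost_shift:
  fixes f :: "real \<Rightarrow> 'a::banach"
  assumes "(f has_integral I) {..t + r}"
  shows "((\<lambda>s. f (s + r)) has_integral I) {..t}"
proof -
  let ?f = "\<lambda>x. if x \<in> {..t + r} then f x else 0"
  let ?g = "\<lambda>x. if x \<in> {..t} then f (x + r) else 0"
  have shift: "?g = ?f \<circ> (+) r" by (auto simp: o_def add.commute)
  show ?thesis
    unfolding has_integral_alt' [of "\<lambda>s. f (s + r)"]
  proof (intro conjI allI impI)
    fix a b :: real
    have "?f integrable_on cbox (a + r) (b + r)"
      using assms unfolding has_integral_alt' by blast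
    then show "?g integrable_on cbox a b"
      unfolding shift using integrable_on_shift_cbox[of ?f r a b] by blast
  next
    fix e :: real assume "0 < e"
    with assms obtain N where N: "N > 0" "\<And>a b. ball 0 N \<subseteq> cbox a b \<Longrightarrow>
        norm (integral (cbox a b) ?f - I) < e"
      unfolding has_integral_alt' by blast
    show "\<exists>N>0. \<forall>a b. ball 0 N \<subseteq> cbox a b \<longrightarrow> norm (integral (cbox a b) ?g - I) < e"
    proof (intro exI conjI allI impI)
      \<comment> \<open>A box around this larger ball, once moved by \<open>r\<close>, still
        contains \<open>ball 0 N\<close>.\<close>
      show "N + \<bar>r\<bar> > 0" using N by auto
      fix a b :: real assume ab: "ball 0 (N + \<bar>r\<bar>) \<subseteq> cbox a b"
      have "ball 0 N \<subseteq> cbox (a + r) (b + r)"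
      proof
        fix x :: real assume "x \<in> ball 0 N"
        then have "x - r \<in> ball 0 (N + \<bar>r\<bar>)" by (auto simp: dist_real_def)
        with ab show "x \<in> cbox (a + r) (b + r)" by force
      qed
      from N(2)[OF this] show "norm (integral (cbox a b) ?g - I) < e"
        unfolding shift integral_shift_cbox_plus .
    qed
  qed
qed

text \<open>Nonnegativity makes a Henstock-Kurzweil integrable function absolutely integrable, hence
  Lebesgue integrable. This gives access to the Fatou lemmas for \<open>ennreal\<close>-valued
  integrals.\<close>

lemma nn_integral_integrable_on:
  fixes h :: "real \<Rightarrow> real"
  assumes "h integrable_on S" "S \<in> sets lebesgue" "\<And>s. s \<in> S \<Longrightarrow> 0 \<le> h s"
  shows "h \<in> borel_measurable (lebesgue_on S)"
    and "(\<integral>\<^sup>+ s. ennreal (h s) \<partial>lebesgue_on S) = ennreal (integral S h)"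
proof -
  have i: "integrable (lebesgue_on S) h"
    using assms by (simp add: absolutely_integrable_imp_integrable nonnegative_absolutely_integrable_1)
  then show "h \<in> borel_measurable (lebesgue_on S)" by simp
  have "AE s in lebesgue_on S. 0 \<le> h s"
    using assms by (intro AE_I2) (simp add: space_restrict_space)
  then show "(\<integral>\<^sup>+ s. ennreal (h s) \<partial>lebesgue_on S) = ennreal (integral S h)"
    using i assms by (simp add: nn_integral_eq_integral lebesgue_integral_eq_integral)
qed

text \<open>With \<open>w\<close> as majorant, the upper limit of the integrals is at most the
  integral of the upper limit. The weight \<open>L\<close> is \<open>ennreal\<close>-valued because
  a lower limit of translates, which may be infinite at some points, will be put in its
  place.\<close>

lemma reverse_Fatou:
  fixes g :: "nat \<Rightarrow> real \<Rightarrow> real" and L :: "real \<Rightarrow> ennreal"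
  assumes S: "S \<in> sets lebesgue"
    and g: "\<And>k. g k integrable_on S" "\<And>k s. s \<in> S \<Longrightarrow> 0 \<le> g k s" "\<And>k s. s \<in> S \<Longrightarrow> g k s \<le> w s"
    and w: "w integrable_on S"
    and L: "L \<in> borel_measurable (lebesgue_on S)" "(\<integral>\<^sup>+ s. L s \<partial>lebesgue_on S) \<le> ennreal K"
    and K: "0 \<le> K" "0 \<le> c"
    and lim: "\<And>s. s \<in> S \<Longrightarrow> limsup (\<lambda>k. ennreal (g k s)) \<le> L s * ennreal c"
    and "0 < \<delta>"
  shows "\<forall>\<^sub>F k in sequentially. integral S (g k) < K * c + \<delta>"
proof -
  note [measurable] = L(1)
  have w0: "0 \<le> w s" if "s \<in> S" for s using g(2,3)[of s 0] that by auto
  note gm [measurable] = nn_integral_integrable_on(1)[OF g(1) S g(2)]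
  note wm [measurable] = nn_integral_integrable_on(1)[OF w S w0]
  have "limsup (\<lambda>k. \<integral>\<^sup>+ s. ennreal (g k s) \<partial>lebesgue_on S)
      \<le> (\<integral>\<^sup>+ s. limsup (\<lambda>k. ennreal (g k s)) \<partial>lebesgue_on S)"
  proof (rule nn_integral_limsup[where w="\<lambda>s. ennreal (w s)"])
    show "AE s in lebesgue_on S. ennreal (g k s) \<le> ennreal (w s)" for k
      using g by (intro AE_I2) (simp add: space_restrict_space ennreal_leI)
    show "(\<integral>\<^sup>+ s. ennreal (w s) \<partial>lebesgue_on S) < \<infinity>"
      using nn_integral_integrable_on(2)[OF w S w0] by simp
  qed measurable
  also have "\<dots> \<le> (\<integral>\<^sup>+ s. L s * ennreal c \<partial>lebesgue_on S)"
    by (intro nn_integral_mono) (simp add: lim space_restrict_space)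
  also have "\<dots> = (\<integral>\<^sup>+ s. L s \<partial>lebesgue_on S) * ennreal c"
    by (rule nn_integral_multc) fact
  also have "\<dots> \<le> ennreal K * ennreal c" by (intro mult_right_mono L) simp
  also have "\<dots> = ennreal (K * c)" using K by (simp add: ennreal_mult)
  also have "\<dots> < ennreal (K * c + \<delta>)" using K \<open>0 < \<delta>\<close> by (intro ennreal_lessI) (auto simp: add_nonneg_pos)
  finally have "\<forall>\<^sub>F k in sequentially. (\<integral>\<^sup>+ s. ennreal (g k s) \<partial>lebesgue_on S) < ennreal (K * c + \<delta>)"
    by (rule Limsup_lessD)
  then show ?thesis
  proof eventually_elim
    case (elim k)
    then show ?case
      using nn_integral_integrable_on(2)[OF g(1) S g(2)] integral_nonneg[OF g(1) g(2)]
      by (simp add: ennreal_less_iff)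
  qed
qed

section \<open>Contraction for pointwise upper limits\<close>

text \<open>If the upper limits of \<open>a\<close> are at most \<open>c\<close> at every point,
  reverse Fatou bounds those of the integrals by \<open>K * c\<close>, and moving
  \<open>Lf * a k t\<close> to the left improves \<open>c\<close> to \<open>\<theta> * c\<close>.
  Iteration from \<open>M\<close> ends at 0. The bound \<open>c\<close> has to serve all points at
  once, since the integral at \<open>t\<close> sees every \<open>s \<le> t\<close>.\<close>

lemma contraction_tendsto_zero:
  fixes a e :: "nat \<Rightarrow> real \<Rightarrow> real" and g :: "nat \<Rightarrow> real \<Rightarrow> real \<Rightarrow> real"
    and L :: "real \<Rightarrow> real \<Rightarrow> ennreal"
  assumes a: "\<And>k t. 0 \<le> a k t" "\<And>k t. a k t \<le> M"
    and est: "\<And>k t. a k t \<le> e k t + Lf * a k t + integral {..t} (g k t)"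
    and e: "\<And>t. (\<lambda>k. e k t) \<longlonglongrightarrow> 0"
    and g: "\<And>k t. g k t integrable_on {..t}" "\<And>k t s. s \<le> t \<Longrightarrow> 0 \<le> g k t s"
      "\<And>k t s. s \<le> t \<Longrightarrow> g k t s \<le> w t s"
    and w: "\<And>t. w t integrable_on {..t}"
    and L: "\<And>t. L t \<in> borel_measurable (lebesgue_on {..t})"
      "\<And>t. (\<integral>\<^sup>+ s. L t s \<partial>lebesgue_on {..t}) \<le> ennreal K"
    and gL: "\<And>t s. s \<le> t \<Longrightarrow> L t s < \<infinity> \<Longrightarrow>
        \<exists>\<eta>. \<eta> \<longlonglongrightarrow> 0 \<and> (\<forall>k. g k t s \<le> \<eta> k + enn2real (L t s) * a k s)"
    and K: "0 \<le> K" "Lf + K < 1"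
  shows "(\<lambda>k. a k t) \<longlonglongrightarrow> 0"
proof -
  \<comment> \<open>This factor comes from solving \<open>a \<le> Lf * a + K * c\<close> for
    \<open>a\<close>; \<open>0 \<le> K\<close> and \<open>Lf + K < 1\<close> give
    \<open>Lf < 1\<close>.\<close>
  define \<theta> where "\<theta> = K / (1 - Lf)"
  have \<theta>: "0 \<le> \<theta>" "\<theta> < 1" using K by (auto simp: \<theta>_def field_simps)
  have M: "0 \<le> M" using a[of 0 0] by linarith
  define P where "P c \<longleftrightarrow> (\<forall>t. \<forall>\<delta>>0. \<forall>\<^sub>F k in sequentially. a k t < c + \<delta>)" for c
  have step: "P (\<theta> * c)" if c: "P c" "0 \<le> c" for c
    unfolding P_def
  proof (intro allI impI)
    fix t \<delta> :: real assume "0 < \<delta>"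
    \<comment> \<open>The integral will contribute \<open>(K + 1) * \<epsilon>\<close> and the data
      error \<open>\<epsilon>\<close>; division of the sum by \<open>1 - Lf\<close> yields
      \<open>\<delta>\<close>.\<close>
    define \<epsilon> where "\<epsilon> = \<delta> * (1 - Lf) / (K + 2)"
    have \<epsilon>: "0 < \<epsilon>" using K \<open>0 < \<delta>\<close> by (simp add: \<epsilon>_def)
    have "limsup (\<lambda>k. ennreal (g k t s)) \<le> L t s * ennreal (c + \<epsilon>)" if s: "s \<le> t" for s
    proof (cases "L t s < \<infinity>")
      \<comment> \<open>The bound is infinite here because \<open>c + \<epsilon>\<close> is
        positive; \<open>c\<close> alone may vanish, and \<open>\<infinity> * 0 = 0\<close> in
        \<open>ennreal\<close>.\<close>
      case False
      then have "L t s * ennreal (c + \<epsilon>) = \<infinity>"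
        using c(2) \<epsilon> by (simp add: ennreal_top_mult less_top[symmetric] ennreal_plus[symmetric] del: ennreal_plus)
      then show ?thesis by simp
    next
      case True
      then obtain \<eta> where \<eta>: "\<eta> \<longlonglongrightarrow> 0" "\<And>k. g k t s \<le> \<eta> k + enn2real (L t s) * a k s"
        using gL[OF s] by blast
      show ?thesis
      proof (rule ennreal_le_epsilon)
        fix d :: real assume d: "0 < d"
        have "\<forall>\<^sub>F k in sequentially. \<eta> k < d" using \<eta>(1) d by (rule order_tendstoD)
        moreover have "\<forall>\<^sub>F k in sequentially. a k s < c + \<epsilon>" using c \<epsilon> by (simp add: P_def)
        ultimately have "\<forall>\<^sub>F k in sequentially. ennreal (g k t s) \<le> L t s * ennreal (c + \<epsilon>) + ennreal d"
        proof eventually_elim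
          case (elim k)
          have "g k t s \<le> enn2real (L t s) * (c + \<epsilon>) + d"
            using \<eta>(2)[of k] mult_left_mono[of "a k s" "c + \<epsilon>" "enn2real (L t s)"] elim by simp
          then have "ennreal (g k t s) \<le> ennreal (enn2real (L t s) * (c + \<epsilon>) + d)" by (rule ennreal_leI)
          also have "\<dots> = L t s * ennreal (c + \<epsilon>) + ennreal d"
            using True c(2) \<epsilon> d by (simp add: ennreal_mult ennreal_plus[symmetric] del: ennreal_plus)
              (simp add: ennreal_mult)
          finally show ?case .
        qed
        then show "limsup (\<lambda>k. ennreal (g k t s)) \<le> L t s * ennreal (c + \<epsilon>) + ennreal d"
          by (rule Limsup_bounded)
      qed
    qed
    then have "\<forall>\<^sub>F k in sequentially. integral {..t} (g k t) < K * (c + \<epsilon>) + \<epsilon>"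
      using g w L K \<epsilon> c(2) by (intro reverse_Fatou[where w="w t" and L="L t"]) auto
    moreover have "\<forall>\<^sub>F k in sequentially. e k t < \<epsilon>" using e \<epsilon> by (rule order_tendstoD)
    ultimately show "\<forall>\<^sub>F k in sequentially. a k t < \<theta> * c + \<delta>"
    proof eventually_elim
      case (elim k)
      have "(1 - Lf) * a k t < K * c + (K + 2) * \<epsilon>" using est[of k t] elim by (simp add: algebra_simps)
      also have "\<dots> = (1 - Lf) * (\<theta> * c + \<delta>)" using K by (simp add: \<epsilon>_def \<theta>_def field_simps)
      finally show ?case using K by simp
    qed
  qed
  have P: "P (\<theta> ^ n * M)" for n
  proof (induction n)
    case 0
    show ?case unfolding P_def using a(2) by (auto intro!: always_eventually le_less_trans[OF a(2)])
  next
    case (Suc n)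
    then show ?case using step[of "\<theta> ^ n * M"] \<theta> M by (simp add: mult.assoc)
  qed
  show ?thesis
  proof (rule order_tendstoI)
    fix b :: real assume "b < 0"
    then show "\<forall>\<^sub>F k in sequentially. b < a k t"
      by (intro always_eventually allI less_le_trans[OF _ a(1)])
  next
    fix b :: real assume b: "0 < b"
    have "(\<lambda>n. \<theta> ^ n * M) \<longlonglongrightarrow> 0" using \<theta> by (intro tendsto_mult_left_zero LIMSEQ_realpow_zero) auto
    then have "\<forall>\<^sub>F n in sequentially. \<theta> ^ n * M < b / 2" using b by (intro order_tendstoD) auto
    then obtain n where n: "\<theta> ^ n * M < b / 2" using eventually_happens by force
    have "\<forall>\<^sub>F k in sequentially. a k t < \<theta> ^ n * M + b / 2"
      using P[of n] b unfolding P_def by auto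
    then show "\<forall>\<^sub>F k in sequentially. a k t < b" by eventually_elim (use n in linarith)
  qed
qed

section \<open>Domination, and uniform limits at moving points\<close>

lemma continuous_dominated_integrable_on:
  fixes v :: "real \<Rightarrow> real"
  assumes "continuous_on UNIV v" "w integrable_on S" "S \<in> sets lebesgue"
    and "\<And>s. s \<in> S \<Longrightarrow> \<bar>v s\<bar> \<le> w s"
  shows "v integrable_on S"
proof (rule measurable_bounded_by_integrable_imp_integrable)
  have "v \<in> borel_measurable borel" using assms(1) by (rule borel_measurable_continuous_onI)
  then show "v \<in> borel_measurable (lebesgue_on S)"
    by (intro measurable_restrict_space1 measurable_completion) simp
qed (use assms in auto)

lemma norm_diff_triangle_quad:
  "norm (a - b) \<le> norm (a - c) + norm (b - d) + norm (c - d)" for a b c d :: "'c::real_normed_vector"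
  using norm_triangle_ineq[of "a - c" "c - b"] norm_triangle_ineq[of "c - d" "d - b"]
    norm_minus_commute[of b d] by simp

text \<open>Uniformity on \<open>B\<close> lets the argument \<open>x k\<close> move with
  \<open>k\<close>. In this way values of \<open>y\<close> are inserted into \<open>F\<close> and
  \<open>D\<close> before anything is known about their convergence.\<close>

lemma uniform_limit_along:
  fixes u :: "nat \<Rightarrow> 'b \<Rightarrow> 'c::real_normed_vector" and x :: "nat \<Rightarrow> 'b"
  assumes "uniform_limit B u v sequentially" "\<And>k::nat. x k \<in> B" "filterlim p at_top sequentially"
  shows "(\<lambda>k. norm (u (p k) (x k) - v (x k))) \<longlonglongrightarrow> 0"
proof (rule tendstoI)
  fix e :: real assume "0 < e"
  then have "\<forall>\<^sub>F n in sequentially. \<forall>x\<in>B. dist (u n x) (v x) < e"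
    using assms(1) by (rule uniform_limitD[rotated])
  then have "\<forall>\<^sub>F k in sequentially. \<forall>x\<in>B. dist (u (p k) x) (v x) < e"
    using assms(3) by (rule eventually_compose_filterlim)
  then show "\<forall>\<^sub>F k in sequentially. dist (norm (u (p k) (x k) - v (x k))) 0 < e"
    by eventually_elim (use assms(2) in \<open>auto simp: dist_norm\<close>)
qed

section \<open>The equation and its translates on a common half-line\<close>

text \<open>The delayed values are recorded as functions \<open>w0 = y \<circ> h0\<close> and \<open>w1 = y \<circ> h1\<close>, which count as
  given data: the contraction constant for \<open>y\<close> alone is \<open>Lf + K\<close>, not twice that.\<close>

locale integral_equation =
  fixes f :: "real \<Rightarrow> 'x::banach \<times> 'x \<Rightarrow> 'x" and C :: "real \<Rightarrow> real \<Rightarrow> 'x \<Rightarrow> 'x \<Rightarrow> 'x"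
    and l m :: "real \<Rightarrow> real \<Rightarrow> real" and Lf K R :: real and y w0 w1 :: "real \<Rightarrow> 'x"
  assumes f_lip: "\<And>t x z x' z'. norm (f t (x, z) - f t (x', z')) \<le> Lf * (norm (x - x') + norm (z - z'))"
    and C_cont: "continuous_on UNIV (\<lambda>(t, s, x, z). C t s x z)"
    and C_bound: "\<And>t s \<tau> x z. norm (C (t + \<tau>) (s + \<tau>) x z) \<le> l t s"
    and l_int: "\<And>t. l t integrable_on {..t}"
    and C_lip: "\<And>t s x z x' z'. norm (C t s x z - C t s x' z') \<le> m t s * (norm (x - x') + norm (z - z'))"
    and m_nonneg: "\<And>t s. 0 \<le> m t s"
    and m_int: "\<And>t. m t integrable_on {..t}"
    and m_le: "\<And>t. integral {..t} (m t) \<le> K"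
    and contraction: "Lf + K < 1"
    and y_cont: "continuous_on UNIV y" and w1_cont: "continuous_on UNIV w1"
    and y_bd: "\<And>t. norm (y t) \<le> R" and w0_bd: "\<And>t. norm (w0 t) \<le> R" and w1_bd: "\<And>t. norm (w1 t) \<le> R"
    and C_int: "\<And>t. (\<lambda>s. C t s (y s) (w1 s)) integrable_on {..t}"
    and y_eq: "\<And>t. y t = f t (y t, w0 t) + integral {..t} (\<lambda>s. C t s (y s) (w1 s))"
begin

text \<open>A single bounded set containing all pairs of values of \<open>y\<close> with
  \<open>w0\<close> or \<open>w1\<close>. Closed balls also keep the pointwise limits of such pairs
  inside, so the same \<open>F\<close> and \<open>D\<close> can be evaluated there.\<close>

definition B where "B = (cball 0 R \<times> cball 0 R :: ('x \<times> 'x) set)"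

text \<open>The integrand of the equation at \<open>t + r\<close>, moved back by \<open>r\<close>:
  all translates are then integrated over the same half-line \<open>{..t}\<close>.\<close>

definition c where "c r t s = C (t + r) (s + r) (y (s + r)) (w1 (s + r))"

lemma B_iff: "(x, z) \<in> B \<longleftrightarrow> norm x \<le> R \<and> norm z \<le> R"
  by (simp add: B_def)

lemma K_nonneg: "0 \<le> K"
  using m_le[of 0] integral_nonneg[OF m_int, of 0] m_nonneg by force

lemma c_bound: "norm (c r t s) \<le> l t s"
  by (simp add: c_def C_bound)

lemma c_cont: "continuous_on UNIV (c r t)"
proof -
  have "continuous_on UNIV (\<lambda>s. y (s + r))" "continuous_on UNIV (\<lambda>s. w1 (s + r))"
    by (rule continuous_on_compose2[OF y_cont _ subset_UNIV] continuous_on_compose2[OF w1_cont _ subset_UNIV];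
        intro continuous_intros)+
  then have "continuous_on UNIV (\<lambda>s. (t + r, s + r, y (s + r), w1 (s + r)))"
    by (intro continuous_intros)
  from continuous_on_compose2[OF C_cont this] show ?thesis
    by (simp add: c_def[abs_def])
qed

lemma c_has_integral: "(c r t has_integral y (t + r) - f (t + r) (y (t + r), w0 (t + r))) {..t}"
proof -
  have "((\<lambda>s. C (t + r) s (y s) (w1 s)) has_integral y (t + r) - f (t + r) (y (t + r), w0 (t + r))) {..t + r}"
    using integrable_integral[OF C_int[of "t + r"]] y_eq[of "t + r"]
    by (metis add_diff_cancel_left')
  from has_integral_atMost_shift[OF this] show ?thesis by (simp add: c_def[abs_def])
qed

lemma c_diff_integrable: "(\<lambda>s. norm (c p t s - c q t s)) integrable_on {..t}"
  and c_diff_bound: "norm (c p t s - c q t s) \<le> 2 * l t s"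
proof -
  show b: "norm (c p t s - c q t s) \<le> 2 * l t s" for s
    using norm_triangle_ineq4[of "c p t s" "c q t s"] c_bound[of p t s] c_bound[of q t s] by linarith
  show "(\<lambda>s. norm (c p t s - c q t s)) integrable_on {..t}"
  proof (rule continuous_dominated_integrable_on)
    show "continuous_on UNIV (\<lambda>s. norm (c p t s - c q t s))"
      by (intro continuous_intros c_cont)
    show "(\<lambda>s. 2 * l t s) integrable_on {..t}" using l_int[of t] by simp
  qed (use b in auto)
qed

lemma y_diff_le:
  "norm (y (t + p) - y (t + q)) \<le> norm (f (t + p) (y (t + p), w0 (t + p)) - f (t + q) (y (t + q), w0 (t + q)))
     + integral {..t} (\<lambda>s. norm (c p t s - c q t s))"
proof -
  let ?i = "\<lambda>r. y (t + r) - f (t + r) (y (t + r), w0 (t + r))"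
  have i: "((\<lambda>s. c p t s - c q t s) has_integral ?i p - ?i q) {..t}"
    by (intro has_integral_diff c_has_integral)
  then have "norm (?i p - ?i q) \<le> integral {..t} (\<lambda>s. norm (c p t s - c q t s))"
    using integral_norm_bound_integral[OF _ c_diff_integrable, of "\<lambda>s. c p t s - c q t s" t p q]
    by (auto simp: integral_unique integrable_on_def)
  moreover have "y (t + p) - y (t + q)
      = (f (t + p) (y (t + p), w0 (t + p)) - f (t + q) (y (t + q), w0 (t + q))) + (?i p - ?i q)"
    by simp
  then have "norm (y (t + p) - y (t + q))
      \<le> norm (f (t + p) (y (t + p), w0 (t + p)) - f (t + q) (y (t + q), w0 (t + q))) + norm (?i p - ?i q)"
    by (simp only: norm_triangle_ineq)
  ultimately show ?thesis by linarith
qed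

end

section \<open>Convergence of the translates along one sequence\<close>

text \<open>Here \<open>\<sigma>\<close> is already a subsequence along which the coefficients and
  the delayed terms converge and return. Convergence of the translates of \<open>y\<close> is to be
  derived.\<close>

locale integral_equation_limit = integral_equation +
  fixes \<sigma> :: "nat \<Rightarrow> real" and F D v0 v1
  assumes F: "\<And>t. uniform_limit B (\<lambda>n x. f (t + \<sigma> n) x) (F t) sequentially"
      "\<And>t. uniform_limit B (\<lambda>n x. F (t - \<sigma> n) x) (f t) sequentially"
    and D: "limit_function_along C B \<sigma> D"
    and v0: "\<And>t. (\<lambda>n. w0 (t + \<sigma> n)) \<longlonglongrightarrow> v0 t" "\<And>t. (\<lambda>n. v0 (t - \<sigma> n)) \<longlonglongrightarrow> w0 t"
    and v1: "\<And>t. (\<lambda>n. w1 (t + \<sigma> n)) \<longlonglongrightarrow> v1 t" "\<And>t. (\<lambda>n. v1 (t - \<sigma> n)) \<longlonglongrightarrow> w1 t"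
begin

lemma C_tendsto_along:
  assumes "\<And>k. (x k, z k) \<in> B" "filterlim p at_top sequentially"
  shows "(\<lambda>k. norm (C (t + \<sigma> (p k)) (s + \<sigma> (p k)) (x k) (z k) - D t s (x k) (z k))) \<longlonglongrightarrow> 0"
  using uniform_limit_along[where x = "\<lambda>k. (x k, z k)",
      OF D[unfolded limit_function_along_def, THEN conjunct1, rule_format, of t s] assms]
  by simp

lemma D_tendsto_along:
  assumes "\<And>k. (x k, z k) \<in> B" "filterlim p at_top sequentially"
  shows "(\<lambda>k. norm (D (t - \<sigma> (p k)) (s - \<sigma> (p k)) (x k) (z k) - C t s (x k) (z k))) \<longlonglongrightarrow> 0"
  using uniform_limit_along[where x = "\<lambda>k. (x k, z k)",
      OF D[unfolded limit_function_along_def, THEN conjunct2, rule_format, of t s] assms]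
  by simp

text \<open>The translates of \<open>m\<close> along \<open>\<sigma>\<close> have no common integrable bound. By Fatou, their lower limit still has
  integral at most \<open>K\<close>, and it is a Lipschitz constant for the limit kernel \<open>D\<close>.
  The Lipschitz function \<open>mu1'\<close> of the theorem cannot take this role, because its integral is uncontrolled.\<close>

definition L where "L t s = liminf (\<lambda>n. ennreal (m (t + \<sigma> n) (s + \<sigma> n)))"

lemma m_shift:
  shows "(\<lambda>s. m (t + r) (s + r)) integrable_on {..t}"
    and "integral {..t} (\<lambda>s. m (t + r) (s + r)) \<le> K"
proof -
  have "((\<lambda>s. m (t + r) (s + r)) has_integral integral {..t + r} (m (t + r))) {..t}"
    by (rule has_integral_atMost_shift[OF integrable_integral[OF m_int]])
  then show "(\<lambda>s. m (t + r) (s + r)) integrable_on {..t}"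
    and "integral {..t} (\<lambda>s. m (t + r) (s + r)) \<le> K"
    using m_le[of "t + r"] by (auto simp: integrable_on_def integral_unique)
qed

lemma L_measurable: "L t \<in> borel_measurable (lebesgue_on {..t})"
proof -
  have "(\<lambda>s. m (t + \<sigma> n) (s + \<sigma> n)) \<in> borel_measurable (lebesgue_on {..t})" for n
    using m_shift(1) by (rule nn_integral_integrable_on) (auto simp: m_nonneg)
  then show ?thesis unfolding L_def[abs_def] by measurable
qed

lemma nn_integral_L: "(\<integral>\<^sup>+ s. L t s \<partial>lebesgue_on {..t}) \<le> ennreal K"
proof -
  have m: "(\<lambda>s. m (t + \<sigma> n) (s + \<sigma> n)) \<in> borel_measurable (lebesgue_on {..t})" for n
    using m_shift(1) by (rule nn_integral_integrable_on) (auto simp: m_nonneg)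
  have "(\<integral>\<^sup>+ s. L t s \<partial>lebesgue_on {..t})
      \<le> liminf (\<lambda>n. \<integral>\<^sup>+ s. ennreal (m (t + \<sigma> n) (s + \<sigma> n)) \<partial>lebesgue_on {..t})"
    unfolding L_def by (rule nn_integral_liminf) (use m in measurable)
  also have "\<dots> = liminf (\<lambda>n. ennreal (integral {..t} (\<lambda>s. m (t + \<sigma> n) (s + \<sigma> n))))"
    using m_shift(1) by (subst nn_integral_integrable_on(2)) (auto simp: m_nonneg)
  also have "\<dots> \<le> ennreal K"
    by (rule Liminf_le) (auto simp: m_shift(2) ennreal_leI)
  finally show ?thesis .
qed

text \<open>For any number above the lower limit, infinitely many translates of \<open>m\<close> at
  this point lie below it. At those indices \<open>C\<close> obeys the smaller Lipschitz bound, and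
  the convergence of the translates of \<open>C\<close> at both pairs hands it to
  \<open>D\<close>.\<close>

lemma D_lip_L:
  assumes "(x, z) \<in> B" "(x', z') \<in> B" "L t s < \<infinity>"
  shows "norm (D t s x z - D t s x' z') \<le> enn2real (L t s) * (norm (x - x') + norm (z - z'))"
proof (rule field_le_epsilon)
  fix e :: real assume e: "0 < e"
  define d where "d = norm (x - x') + norm (z - z')"
  have d: "0 \<le> d" by (simp add: d_def)
  \<comment> \<open>Multiplied by \<open>d\<close>, the increment costs at most \<open>e\<close>;
    the summand 1 covers \<open>d = 0\<close>.\<close>
  define \<mu> where "\<mu> = enn2real (L t s) + e / (d + 1)"
  have "L t s < ennreal \<mu>"
  proof -
    have "L t s = ennreal (enn2real (L t s))" using assms(3) by simp
    also have "\<dots> < ennreal \<mu>" using e d by (intro ennreal_lessI) (auto simp: \<mu>_def intro!: add_nonneg_pos)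
    finally show ?thesis .
  qed
  have freq: "\<exists>\<^sub>F n in sequentially. m (t + \<sigma> n) (s + \<sigma> n) < \<mu>"
    unfolding frequently_def
  proof (intro notI)
    assume "\<forall>\<^sub>F n in sequentially. \<not> m (t + \<sigma> n) (s + \<sigma> n) < \<mu>"
    then have "\<forall>\<^sub>F n in sequentially. ennreal \<mu> \<le> ennreal (m (t + \<sigma> n) (s + \<sigma> n))"
      by eventually_elim (simp add: ennreal_leI)
    then have "ennreal \<mu> \<le> L t s" unfolding L_def by (rule Liminf_bounded)
    with \<open>L t s < ennreal \<mu>\<close> show False by simp
  qed
  have lim: "(\<lambda>n. C (t + \<sigma> n) (s + \<sigma> n) x z) \<longlonglongrightarrow> D t s x z" if "(x, z) \<in> B" for x z
    using C_tendsto_along[of "\<lambda>_. x" "\<lambda>_. z" "\<lambda>n. n" t s] that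
    by (auto intro!: LIM_zero_cancel[OF tendsto_norm_zero_cancel] simp: filterlim_ident)
  \<comment> \<open>If the limit exceeded \<open>\<mu> * d\<close>, so would the differences of
    \<open>C\<close> from some index on, forcing the translates of \<open>m\<close> to stay at or
    above \<open>\<mu>\<close>.\<close>
  have "norm (D t s x z - D t s x' z') \<le> \<mu> * d"
  proof (rule ccontr)
    assume "\<not> ?thesis"
    moreover have "(\<lambda>n. norm (C (t + \<sigma> n) (s + \<sigma> n) x z - C (t + \<sigma> n) (s + \<sigma> n) x' z'))
        \<longlonglongrightarrow> norm (D t s x z - D t s x' z')"
      by (intro tendsto_intros lim assms)
    ultimately have "\<forall>\<^sub>F n in sequentially. \<mu> * d < norm (C (t + \<sigma> n) (s + \<sigma> n) x z - C (t + \<sigma> n) (s + \<sigma> n) x' z')"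
      by (intro order_tendstoD) auto
    then have "\<forall>\<^sub>F n in sequentially. \<not> m (t + \<sigma> n) (s + \<sigma> n) < \<mu>"
    proof eventually_elim
      case (elim n)
      then have "\<mu> * d < m (t + \<sigma> n) (s + \<sigma> n) * d"
        using C_lip[of "t + \<sigma> n" "s + \<sigma> n" x z x' z'] unfolding d_def by linarith
      then show ?case using d by (meson less_imp_le mult_right_mono not_le)
    qed
    with freq show False by (simp add: frequently_def)
  qed
  also have "\<mu> * d \<le> enn2real (L t s) * d + e"
    using e d by (simp add: \<mu>_def algebra_simps divide_simps)
  finally show "norm (D t s x z - D t s x' z') \<le> enn2real (L t s) * (norm (x - x') + norm (z - z')) + e"
    by (simp add: d_def)
qed

text \<open>Two index sequences express the Cauchy property, since no limit of \<open>y\<close> is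
  available yet. The translates are compared through \<open>F\<close> and \<open>D\<close> at the
  moving values of \<open>y\<close>; the change of argument costs \<open>Lf\<close> in
  \<open>f\<close> and \<open>L t s\<close> in \<open>D\<close>, while the delayed terms go into the
  null errors.\<close>

lemma translates_Cauchy:
  assumes p: "filterlim p at_top sequentially" and q: "filterlim q at_top sequentially"
  shows "(\<lambda>k. norm (y (t + \<sigma> (p k)) - y (t + \<sigma> (q k)))) \<longlonglongrightarrow> 0"
proof (rule contraction_tendsto_zero[where L=L and K=K and Lf=Lf and M="2*R" and w="\<lambda>t s. 2 * l t s"
      and g="\<lambda>k t s. norm (c (\<sigma> (p k)) t s - c (\<sigma> (q k)) t s)"
      and a="\<lambda>k t. norm (y (t + \<sigma> (p k)) - y (t + \<sigma> (q k)))"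
      and e="\<lambda>k t. norm (f (t + \<sigma> (p k)) (y (t + \<sigma> (p k)), w0 (t + \<sigma> (p k))) - F t (y (t + \<sigma> (p k)), w0 (t + \<sigma> (p k))))
        + norm (f (t + \<sigma> (q k)) (y (t + \<sigma> (p k)), w0 (t + \<sigma> (p k))) - F t (y (t + \<sigma> (p k)), w0 (t + \<sigma> (p k))))
        + Lf * norm (w0 (t + \<sigma> (p k)) - w0 (t + \<sigma> (q k)))"])
  fix t :: real
  let ?u = "\<lambda>k::nat. (y (t + \<sigma> (p k)), w0 (t + \<sigma> (p k)))"
  have w: "(\<lambda>k. norm (w0 (t + \<sigma> (p k)) - w0 (t + \<sigma> (q k)))) \<longlonglongrightarrow> norm (v0 t - v0 t)"
    by (intro tendsto_intros filterlim_compose[OF v0(1)] p q)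
  have f: "(\<lambda>k. norm (f (t + \<sigma> (r k)) (?u k) - F t (?u k))) \<longlonglongrightarrow> 0"
    if "filterlim r at_top sequentially" for r
    using that by (intro uniform_limit_along[OF F(1)]) (auto simp: B_iff y_bd w0_bd)
  show "(\<lambda>k. norm (f (t + \<sigma> (p k)) (?u k) - F t (?u k)) + norm (f (t + \<sigma> (q k)) (?u k) - F t (?u k))
        + Lf * norm (w0 (t + \<sigma> (p k)) - w0 (t + \<sigma> (q k)))) \<longlonglongrightarrow> 0"
    using tendsto_add[OF tendsto_add[OF f[OF p] f[OF q]] tendsto_mult_left[OF w, of Lf]] by simp
next
  fix k :: nat and t :: real
  show "norm (y (t + \<sigma> (p k)) - y (t + \<sigma> (q k))) \<le> 2 * R"
    using norm_triangle_ineq4[of "y (t + \<sigma> (p k))" "y (t + \<sigma> (q k))"] y_bd[of "t + \<sigma> (p k)"] y_bd[of "t + \<sigma> (q k)"]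
    by linarith
  let ?u = "(y (t + \<sigma> (p k)), w0 (t + \<sigma> (p k)))" and ?u' = "(y (t + \<sigma> (q k)), w0 (t + \<sigma> (q k)))"
  \<comment> \<open>Both errors are taken at the argument with index \<open>p k\<close>, and the
    argument is then changed inside \<open>f\<close>, since \<open>Lf\<close> is valid at every
    time. For the kernel, \<open>m\<close> varies with the shift, so there the arguments are changed
    inside \<open>D\<close>.\<close>
  have "norm (f (t + \<sigma> (p k)) ?u - f (t + \<sigma> (q k)) ?u')
    \<le> norm (f (t + \<sigma> (p k)) ?u - F t ?u) + norm (f (t + \<sigma> (q k)) ?u - F t ?u) + norm (f (t + \<sigma> (q k)) ?u - f (t + \<sigma> (q k)) ?u')"
    using norm_diff_triangle_quad[of "f (t + \<sigma> (p k)) ?u" "f (t + \<sigma> (q k)) ?u'" "F t ?u" "f (t + \<sigma> (q k)) ?u"]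
    by (simp add: norm_minus_commute)
  then show "norm (y (t + \<sigma> (p k)) - y (t + \<sigma> (q k))) \<le>
      norm (f (t + \<sigma> (p k)) ?u - F t ?u) + norm (f (t + \<sigma> (q k)) ?u - F t ?u)
        + Lf * norm (w0 (t + \<sigma> (p k)) - w0 (t + \<sigma> (q k)))
      + Lf * norm (y (t + \<sigma> (p k)) - y (t + \<sigma> (q k)))
      + integral {..t} (\<lambda>s. norm (c (\<sigma> (p k)) t s - c (\<sigma> (q k)) t s))"
    using y_diff_le[of t "\<sigma> (p k)" "\<sigma> (q k)"]
      f_lip[of "t + \<sigma> (q k)" "y (t + \<sigma> (p k))" "w0 (t + \<sigma> (p k))" "y (t + \<sigma> (q k))" "w0 (t + \<sigma> (q k))"]
    unfolding distrib_left by linarith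
next
  fix t s :: real assume fin: "L t s < \<infinity>"
  let ?d = "\<lambda>(r::nat \<Rightarrow> nat) (k::nat). norm (c (\<sigma> (r k)) t s - D t s (y (s + \<sigma> (r k))) (w1 (s + \<sigma> (r k))))"
  let ?w = "\<lambda>k::nat. norm (w1 (s + \<sigma> (p k)) - w1 (s + \<sigma> (q k)))"
  show "\<exists>\<eta>. \<eta> \<longlonglongrightarrow> 0 \<and> (\<forall>k. norm (c (\<sigma> (p k)) t s - c (\<sigma> (q k)) t s)
      \<le> \<eta> k + enn2real (L t s) * norm (y (s + \<sigma> (p k)) - y (s + \<sigma> (q k))))"
  proof (intro exI[of _ "\<lambda>k. ?d p k + ?d q k + enn2real (L t s) * ?w k"] conjI allI)
    have w: "?w \<longlonglongrightarrow> norm (v1 s - v1 s)"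
      by (intro tendsto_intros filterlim_compose[OF v1(1)] p q)
    have d: "?d r \<longlonglongrightarrow> 0" if "filterlim r at_top sequentially" for r
      unfolding c_def using that by (intro C_tendsto_along) (auto simp: B_iff y_bd w1_bd)
    show "(\<lambda>k. ?d p k + ?d q k + enn2real (L t s) * ?w k) \<longlonglongrightarrow> 0"
      using tendsto_add[OF tendsto_add[OF d[OF p] d[OF q]] tendsto_mult_left[OF w, of "enn2real (L t s)"]]
      by simp
    fix k :: nat
    let ?D = "\<lambda>r. D t s (y (s + \<sigma> (r k))) (w1 (s + \<sigma> (r k)))"
    have "norm (c (\<sigma> (p k)) t s - c (\<sigma> (q k)) t s) \<le> ?d p k + ?d q k + norm (?D p - ?D q)"
      by (rule norm_diff_triangle_quad)
    then show "norm (c (\<sigma> (p k)) t s - c (\<sigma> (q k)) t s)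
        \<le> ?d p k + ?d q k + enn2real (L t s) * ?w k + enn2real (L t s) * norm (y (s + \<sigma> (p k)) - y (s + \<sigma> (q k)))"
      using D_lip_L[OF _ _ fin, of "y (s + \<sigma> (p k))" "w1 (s + \<sigma> (p k))" "y (s + \<sigma> (q k))" "w1 (s + \<sigma> (q k))"]
      by (simp add: B_iff y_bd w1_bd distrib_left)
  qed
next
  show "(\<lambda>s. 2 * l t s) integrable_on {..t}" for t using l_int[of t] by simp
qed (simp_all add: c_diff_integrable c_diff_bound L_measurable nn_integral_L K_nonneg contraction)

text \<open>If the Cauchy property failed, there would be indices \<open>p k\<close> and
  \<open>q k\<close>, both at least \<open>k\<close>, whose translates stay \<open>e\<close> apart,
  against \<open>translates_Cauchy\<close>. Completeness then gives the limit.\<close>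

lemma translates_convergent: "\<exists>v. \<forall>t. (\<lambda>n. y (t + \<sigma> n)) \<longlonglongrightarrow> v t"
proof (intro choice allI)
  fix t
  let ?Y = "\<lambda>n. y (t + \<sigma> n)"
  have "Cauchy ?Y"
  proof (rule ccontr)
    assume "\<not> Cauchy ?Y"
    then obtain e where e: "e > 0" and "\<forall>M. \<exists>i\<ge>M. \<exists>j\<ge>M. \<not> norm (?Y i - ?Y j) < e"
      unfolding Cauchy_def dist_norm by blast
    then obtain p q where pq: "\<And>k. k \<le> p k" "\<And>k. k \<le> q k" "\<And>k. \<not> norm (?Y (p k) - ?Y (q k)) < e"
      by metis
    have "filterlim p at_top sequentially" "filterlim q at_top sequentially"
      using pq by (auto intro!: filterlim_at_top_mono[OF filterlim_ident] always_eventually)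
    from translates_Cauchy[OF this] e have "\<forall>\<^sub>F k in sequentially. norm (?Y (p k) - ?Y (q k)) < e"
      by (rule order_tendstoD)
    with pq(3) show False by simp
  qed
  then show "\<exists>a. ?Y \<longlonglongrightarrow> a" by (simp add: Cauchy_convergent_iff convergent_def)
qed

section \<open>Return of the limit to the solution\<close>

text \<open>The estimate for the shifts \<open>\<sigma> n - \<sigma> k\<close> and 0 is passed to
  the limit in \<open>n\<close>, which replaces the translate of \<open>y\<close> by
  \<open>v (t - \<sigma> k)\<close>. The contraction argument is then applied in \<open>k\<close>,
  with \<open>F\<close> and \<open>D\<close> returning to \<open>f\<close> and
  \<open>C\<close>.\<close>

lemma limit_translates_back:
  assumes v: "\<And>t. (\<lambda>n. y (t + \<sigma> n)) \<longlonglongrightarrow> v t"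
    and D_lip: "\<And>t s x z x' z'. (x, z) \<in> B \<Longrightarrow> (x', z') \<in> B \<Longrightarrow>
      norm (D t s x z - D t s x' z') \<le> m' t s * (norm (x - x') + norm (z - z'))"
  shows "(\<lambda>n. v (t - \<sigma> n)) \<longlonglongrightarrow> y t"
proof -
  have bd: "norm (v t) \<le> R" "norm (v0 t) \<le> R" "norm (v1 t) \<le> R" for t
    using LIMSEQ_le_const2[OF tendsto_norm[OF v], of t R] LIMSEQ_le_const2[OF tendsto_norm[OF v0(1)], of t R]
      LIMSEQ_le_const2[OF tendsto_norm[OF v1(1)], of t R] by (auto simp: y_bd w0_bd w1_bd)
  have f_lim: "(\<lambda>n. f (t + \<sigma> n) (y (t + \<sigma> n), w0 (t + \<sigma> n))) \<longlonglongrightarrow> F t (v t, v0 t)" for t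
  proof (rule LIM_zero_cancel, rule Lim_null_comparison[OF always_eventually[OF allI]])
    let ?V = "(v t, v0 t)"
    fix n
    show "norm (f (t + \<sigma> n) (y (t + \<sigma> n), w0 (t + \<sigma> n)) - F t ?V)
      \<le> norm (f (t + \<sigma> n) ?V - F t ?V) + Lf * (norm (y (t + \<sigma> n) - v t) + norm (w0 (t + \<sigma> n) - v0 t))"
      using norm_triangle_ineq[of "f (t + \<sigma> n) (y (t + \<sigma> n), w0 (t + \<sigma> n)) - f (t + \<sigma> n) ?V" "f (t + \<sigma> n) ?V - F t ?V"]
        f_lip[of "t + \<sigma> n" "y (t + \<sigma> n)" "w0 (t + \<sigma> n)" "v t" "v0 t"] by simp
  next
    let ?V = "(v t, v0 t)"
    have "(\<lambda>n. norm (f (t + \<sigma> n) ?V - F t ?V)) \<longlonglongrightarrow> 0"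
      using F(1) by (rule uniform_limit_along) (auto simp: B_iff bd filterlim_ident)
    moreover have "(\<lambda>n. Lf * (norm (y (t + \<sigma> n) - v t) + norm (w0 (t + \<sigma> n) - v0 t)))
        \<longlonglongrightarrow> Lf * (norm (v t - v t) + norm (v0 t - v0 t))"
      by (intro tendsto_intros v v0)
    ultimately show "(\<lambda>n. norm (f (t + \<sigma> n) ?V - F t ?V)
        + Lf * (norm (y (t + \<sigma> n) - v t) + norm (w0 (t + \<sigma> n) - v0 t))) \<longlonglongrightarrow> 0"
      using tendsto_add by fastforce
  qed
  \<comment> \<open>The constant \<open>m' t s\<close> is finite at every point, also where
    \<open>L t s\<close> is infinite, so the integrands converge at all fixed \<open>t\<close> and
    \<open>s\<close>.\<close>
  have C_lim: "(\<lambda>n. C (t + \<sigma> n) (s + \<sigma> n) (y (s + \<sigma> n)) (w1 (s + \<sigma> n))) \<longlonglongrightarrow> D t s (v s) (v1 s)" for t s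
  proof (rule LIM_zero_cancel, rule Lim_null_comparison[OF always_eventually[OF allI]])
    fix n
    let ?y = "y (s + \<sigma> n)" and ?w = "w1 (s + \<sigma> n)"
    show "norm (C (t + \<sigma> n) (s + \<sigma> n) ?y ?w - D t s (v s) (v1 s))
      \<le> norm (C (t + \<sigma> n) (s + \<sigma> n) ?y ?w - D t s ?y ?w) + m' t s * (norm (?y - v s) + norm (?w - v1 s))"
      using norm_triangle_ineq[of "C (t + \<sigma> n) (s + \<sigma> n) ?y ?w - D t s ?y ?w" "D t s ?y ?w - D t s (v s) (v1 s)"]
        D_lip[of ?y ?w "v s" "v1 s" t s] by (simp add: B_iff bd y_bd w1_bd)
  next
    let ?y = "\<lambda>n. y (s + \<sigma> n)" and ?w = "\<lambda>n. w1 (s + \<sigma> n)"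
    have "(\<lambda>n. norm (C (t + \<sigma> n) (s + \<sigma> n) (?y n) (?w n) - D t s (?y n) (?w n))) \<longlonglongrightarrow> 0"
      by (rule C_tendsto_along) (auto simp: B_iff y_bd w1_bd filterlim_ident)
    moreover have "(\<lambda>n. m' t s * (norm (?y n - v s) + norm (?w n - v1 s)))
        \<longlonglongrightarrow> m' t s * (norm (v s - v s) + norm (v1 s - v1 s))"
      by (intro tendsto_intros v v1)
    ultimately show "(\<lambda>n. norm (C (t + \<sigma> n) (s + \<sigma> n) (?y n) (?w n) - D t s (?y n) (?w n))
        + m' t s * (norm (?y n - v s) + norm (?w n - v1 s))) \<longlonglongrightarrow> 0"
      using tendsto_add by fastforce
  qed
  let ?g = "\<lambda>k t s. norm (D (t - \<sigma> k) (s - \<sigma> k) (v (s - \<sigma> k)) (v1 (s - \<sigma> k)) - C t s (y s) (w1 s))"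
  have shift: "t + (\<sigma> n - \<sigma> k) = (t - \<sigma> k) + \<sigma> n" for t n k by simp
  have c_lim: "(\<lambda>n. norm (c (\<sigma> n - \<sigma> k) t s - c 0 t s)) \<longlonglongrightarrow> ?g k t s" for k t s
    unfolding c_def shift add_0_right by (intro tendsto_intros C_lim)
  have l2: "(\<lambda>s. 2 * l t s) integrable_on {..t}" for t using l_int[of t] by simp
  \<comment> \<open>Dominated convergence in \<open>n\<close> also yields the integrability of the
    limit integrand \<open>?g k t\<close>, for which no continuity is known.\<close>
  note dom = dominated_convergence[where f="\<lambda>n s. norm (c (\<sigma> n - \<sigma> k) t s - c 0 t s)"
    and g="?g k t" and S="{..t}" and h="\<lambda>s. 2 * l t s" for k t, OF c_diff_integrable l2 _ c_lim]
  have g_int: "?g k t integrable_on {..t}" for k t by (rule dom(1)) (simp add: c_diff_bound)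
  have g_le: "?g k t s \<le> 2 * l t s" for k t s
    by (rule LIMSEQ_le_const2[OF c_lim]) (simp add: c_diff_bound)
  let ?V = "\<lambda>k t. (v (t - \<sigma> k), v0 (t - \<sigma> k))"
  have est: "norm (v (t - \<sigma> k) - y t) \<le> norm (F (t - \<sigma> k) (?V k t) - f t (y t, w0 t)) + integral {..t} (?g k t)" for k t
  proof (rule LIMSEQ_le)
    show "(\<lambda>n. norm (y (t + (\<sigma> n - \<sigma> k)) - y (t + 0))) \<longlonglongrightarrow> norm (v (t - \<sigma> k) - y t)"
      unfolding shift add_0_right by (intro tendsto_intros v)
    have "(\<lambda>n. integral {..t} (\<lambda>s. norm (c (\<sigma> n - \<sigma> k) t s - c 0 t s))) \<longlonglongrightarrow> integral {..t} (?g k t)"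
      by (rule dom(2)) (simp add: c_diff_bound)
    moreover have "(\<lambda>n. norm (f (t + (\<sigma> n - \<sigma> k)) (y (t + (\<sigma> n - \<sigma> k)), w0 (t + (\<sigma> n - \<sigma> k)))
        - f (t + 0) (y (t + 0), w0 (t + 0)))) \<longlonglongrightarrow> norm (F (t - \<sigma> k) (?V k t) - f t (y t, w0 t))"
      unfolding shift add_0_right by (intro tendsto_intros f_lim)
    ultimately show "(\<lambda>n. norm (f (t + (\<sigma> n - \<sigma> k)) (y (t + (\<sigma> n - \<sigma> k)), w0 (t + (\<sigma> n - \<sigma> k)))
        - f (t + 0) (y (t + 0), w0 (t + 0))) + integral {..t} (\<lambda>s. norm (c (\<sigma> n - \<sigma> k) t s - c 0 t s)))
      \<longlonglongrightarrow> norm (F (t - \<sigma> k) (?V k t) - f t (y t, w0 t)) + integral {..t} (?g k t)"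
      by (rule tendsto_add[rotated])
  qed (use y_diff_le in blast)
  \<comment> \<open>The weight is now \<open>m\<close> itself: \<open>D\<close> is first returned to
    \<open>C\<close> at the values of \<open>v\<close> and \<open>v1\<close>, and the change to
    \<open>y\<close> and \<open>w1\<close> happens inside \<open>C\<close> at the unshifted
    times.\<close>
  have "(\<lambda>k. norm (v (t - \<sigma> k) - y t)) \<longlonglongrightarrow> 0"
  proof (rule contraction_tendsto_zero[where L="\<lambda>t s. ennreal (m t s)" and K=K and Lf=Lf and M="2*R"
      and w="\<lambda>t s. 2 * l t s" and g="?g" and a="\<lambda>k t. norm (v (t - \<sigma> k) - y t)"
      and e="\<lambda>k t. norm (F (t - \<sigma> k) (?V k t) - f t (?V k t)) + Lf * norm (v0 (t - \<sigma> k) - w0 t)"])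
    fix t :: real
    have "(\<lambda>k. norm (F (t - \<sigma> k) (?V k t) - f t (?V k t))) \<longlonglongrightarrow> 0"
      using F(2) by (rule uniform_limit_along) (auto simp: B_iff bd filterlim_ident)
    moreover have "(\<lambda>k. Lf * norm (v0 (t - \<sigma> k) - w0 t)) \<longlonglongrightarrow> Lf * norm (w0 t - w0 t)"
      by (intro tendsto_intros v0)
    ultimately show "(\<lambda>k. norm (F (t - \<sigma> k) (?V k t) - f t (?V k t)) + Lf * norm (v0 (t - \<sigma> k) - w0 t)) \<longlonglongrightarrow> 0"
      using tendsto_add by fastforce
  next
    fix k :: nat and t :: real
    show "norm (v (t - \<sigma> k) - y t) \<le> 2 * R"
      using norm_triangle_ineq4[of "v (t - \<sigma> k)" "y t"] bd(1)[of "t - \<sigma> k"] y_bd[of t] by linarith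
    have "norm (F (t - \<sigma> k) (?V k t) - f t (y t, w0 t))
      \<le> norm (F (t - \<sigma> k) (?V k t) - f t (?V k t)) + norm (f t (?V k t) - f t (y t, w0 t))"
      using norm_triangle_ineq[of "F (t - \<sigma> k) (?V k t) - f t (?V k t)" "f t (?V k t) - f t (y t, w0 t)"] by simp
    then show "norm (v (t - \<sigma> k) - y t) \<le> norm (F (t - \<sigma> k) (?V k t) - f t (?V k t))
        + Lf * norm (v0 (t - \<sigma> k) - w0 t) + Lf * norm (v (t - \<sigma> k) - y t) + integral {..t} (?g k t)"
      using est[of t k] f_lip[of t "v (t - \<sigma> k)" "v0 (t - \<sigma> k)" "y t" "w0 t"]
      unfolding distrib_left by linarith
  next
    fix t s :: real
    let ?d = "\<lambda>k::nat. norm (D (t - \<sigma> k) (s - \<sigma> k) (v (s - \<sigma> k)) (v1 (s - \<sigma> k)) - C t s (v (s - \<sigma> k)) (v1 (s - \<sigma> k)))"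
    let ?w = "\<lambda>k::nat. norm (v1 (s - \<sigma> k) - w1 s)"
    show "\<exists>\<eta>. \<eta> \<longlonglongrightarrow> 0 \<and> (\<forall>k. ?g k t s \<le> \<eta> k + enn2real (ennreal (m t s)) * norm (v (s - \<sigma> k) - y s))"
    proof (intro exI[of _ "\<lambda>k. ?d k + m t s * ?w k"] conjI allI)
      have "?d \<longlonglongrightarrow> 0" by (rule D_tendsto_along) (auto simp: B_iff bd filterlim_ident)
      moreover have "(\<lambda>k. m t s * ?w k) \<longlonglongrightarrow> m t s * norm (w1 s - w1 s)" by (intro tendsto_intros v1)
      ultimately show "(\<lambda>k. ?d k + m t s * ?w k) \<longlonglongrightarrow> 0" using tendsto_add by fastforce
      fix k :: nat
      let ?V = "C t s (v (s - \<sigma> k)) (v1 (s - \<sigma> k))"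
      have "?g k t s \<le> ?d k + norm (?V - C t s (y s) (w1 s))"
        using norm_triangle_ineq[of "D (t - \<sigma> k) (s - \<sigma> k) (v (s - \<sigma> k)) (v1 (s - \<sigma> k)) - ?V" "?V - C t s (y s) (w1 s)"]
        by simp
      then show "?g k t s \<le> ?d k + m t s * ?w k + enn2real (ennreal (m t s)) * norm (v (s - \<sigma> k) - y s)"
        using C_lip[of t s "v (s - \<sigma> k)" "v1 (s - \<sigma> k)" "y s" "w1 s"] m_nonneg[of t s]
        by (simp add: distrib_left)
    qed
  next
    fix t :: real
    have m: "m t \<in> borel_measurable (lebesgue_on {..t})" "(\<integral>\<^sup>+ s. ennreal (m t s) \<partial>lebesgue_on {..t}) = ennreal (integral {..t} (m t))"
      using m_int by (rule nn_integral_integrable_on; simp add: m_nonneg)+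
    show "(\<lambda>s. ennreal (m t s)) \<in> borel_measurable (lebesgue_on {..t})" using m(1) by measurable
    show "(\<integral>\<^sup>+ s. ennreal (m t s) \<partial>lebesgue_on {..t}) \<le> ennreal K" by (simp add: m(2) m_le ennreal_leI)
  qed (simp_all add: g_int g_le l2 K_nonneg contraction)
  then show ?thesis by (rule LIM_zero_cancel[OF tendsto_norm_zero_cancel])
qed

end

section \<open>Composition and range of almost automorphic functions\<close>

lemma almost_automorphic_compose:
  fixes y :: "real \<Rightarrow> 'x::banach"
  assumes "almost_automorphic h" "continuous_on UNIV y" "bounded (range y)"
  shows "almost_automorphic (\<lambda>t. y (h t))"
  unfolding almost_automorphic_def
proof (intro conjI allI)
  show "bounded (range (\<lambda>t. y (h t)))" by (rule bounded_subset[OF assms(3)]) auto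
  show "continuous_on UNIV (\<lambda>t. y (h t))"
    using assms by (auto simp: almost_automorphic_def intro: continuous_on_compose2)
  fix \<sigma> :: "nat \<Rightarrow> real"
  obtain r g where r: "strict_mono r" and g: "\<And>t. (\<lambda>n. h (t + \<sigma> (r n))) \<longlonglongrightarrow> g t"
      "\<And>t. (\<lambda>n. g (t - \<sigma> (r n))) \<longlonglongrightarrow> h t"
    using assms(1) unfolding almost_automorphic_def by meson
  have y: "isCont y x" for x using assms(2) by (simp add: continuous_on_eq_continuous_at)
  show "\<exists>r g. strict_mono r \<and> (\<forall>t. (\<lambda>n. y (h (t + \<sigma> (r n)))) \<longlonglongrightarrow> g t) \<and>
      (\<forall>t. (\<lambda>n. g (t - \<sigma> (r n))) \<longlonglongrightarrow> y (h t))"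
    by (intro exI[of _ r] exI[of _ "\<lambda>t. y (g t)"] conjI allI r isCont_tendsto_compose[OF y] g)
qed

text \<open>Points of the closure are approximated by values of \<open>y\<close> at times
  \<open>\<tau> n\<close>, with errors tending to 0. These times serve as the translation sequence
  at the base point 0.\<close>

lemma almost_automorphic_imp_compact_closure_range:
  assumes "almost_automorphic y"
  shows "compact (closure (range y))"
  unfolding compact_eq_seq_compact_metric seq_compact_def
proof (intro allI impI)
  fix x :: "nat \<Rightarrow> 'a" assume x: "\<forall>n. x n \<in> closure (range y)"
  have "\<exists>t. dist (y t) (x n) < 1 / real (Suc n)" for n
    using x[rule_format, of n] by (force simp: closure_approachable)
  then obtain \<tau> where \<tau>: "\<And>n. dist (y (\<tau> n)) (x n) < 1 / real (Suc n)" by metis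
  obtain r g where r: "strict_mono r" and g: "\<And>t. (\<lambda>n. y (t + \<tau> (r n))) \<longlonglongrightarrow> g t"
    using assms unfolding almost_automorphic_def by meson
  have "(\<lambda>n. x n - y (\<tau> n)) \<longlonglongrightarrow> 0"
    by (rule Lim_null_comparison[OF always_eventually[OF allI] LIMSEQ_inverse_real_of_nat])
      (use less_imp_le[OF \<tau>] in \<open>simp add: dist_norm norm_minus_commute inverse_eq_divide\<close>)
  then have "(\<lambda>n. (x \<circ> r) n - y (\<tau> (r n))) \<longlonglongrightarrow> 0"
    using LIMSEQ_subseq_LIMSEQ[OF _ r] by (fastforce simp: o_def)
  from tendsto_add[OF this g[of 0]] have "(x \<circ> r) \<longlonglongrightarrow> g 0" by (simp add: o_def)
  moreover from this have "g 0 \<in> closure (range y)"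
    using x closed_sequentially[OF closed_closure, of "x \<circ> r"] by auto
  ultimately show "\<exists>l\<in>closure (range y). \<exists>r. strict_mono r \<and> (x \<circ> r) \<longlonglongrightarrow> l"
    using r by blast
qed

section \<open>Almost automorphy and relatively compact range of a bounded solution\<close>

theorem theorem4p4:
  fixes C1 :: "real \<Rightarrow> real \<Rightarrow> 'x::banach \<Rightarrow> 'x \<Rightarrow> 'x"
    and lam1 mu1 mu1' :: "real \<Rightarrow> real \<Rightarrow> real"
    and f :: "real \<Rightarrow> 'x \<times> 'x \<Rightarrow> 'x"
    and Lf \<rho> :: real
    and h0 h1 :: "real \<Rightarrow> real"
    and y :: "real \<Rightarrow> 'x"
  assumes "admissible_kernel C1 lam1 mu1 mu1'"
    and "almost_automorphic_unif f"
    and "\<And>B t x z x1 z1. bounded B \<Longrightarrow> (x, z) \<in> B \<Longrightarrow> (x1, z1) \<in> B \<Longrightarrow>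
           norm (f t (x, z) - f t (x1, z1)) \<le> Lf * (norm (x - x1) + norm (z - z1))"
    and "Lf + (SUP t. integral {..t} (mu1 t)) = \<rho>" and "\<rho> < 1"
    and "almost_automorphic h0" and "almost_automorphic h1"
    and "integral_equation_solution f C1 h0 h1 y" and "bounded (range y)"
  shows "almost_automorphic y \<longleftrightarrow> compact (closure (range y))"
proof
  show "compact (closure (range y))" if "almost_automorphic y"
    using that by (rule almost_automorphic_imp_compact_closure_range)
next
  have bi: "bi_almost_automorphic C1" and bd: "lambda_bounded lam1 C1"
    and lip: "kernel_lipschitz mu1 mu1' C1"
    and lam: "sup_integral_finite lam1" and mu: "sup_integral_finite mu1"
    using assms(1) by (auto simp: admissible_kernel_def)
  obtain R where R: "\<And>t. norm (y t) \<le> R"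
    using assms(9) by (auto simp: bounded_iff)
  have y_cont: "continuous_on UNIV y"
    using assms(8) by (simp add: integral_equation_solution_def)
  define w0 w1 where "w0 = (\<lambda>t. y (h0 t))" and "w1 = (\<lambda>t. y (h1 t))"
  have w0: "almost_automorphic w0" and w1: "almost_automorphic w1"
    unfolding w0_def w1_def using assms(6,7,9) y_cont by (auto intro: almost_automorphic_compose)
  \<comment> \<open>The Lipschitz and boundedness conditions have the same constants on every
    bounded set, so applying them to sets of one or two points gives bounds on the whole
    space.\<close>
  interpret integral_equation f C1 lam1 mu1 Lf "SUP t. integral {..t} (mu1 t)" R y w0 w1
  proof
    fix t s \<tau> :: real and x z x' z' :: 'x
    show "norm (f t (x, z) - f t (x', z')) \<le> Lf * (norm (x - x') + norm (z - z'))"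
      using assms(3)[of "{(x, z), (x', z')}"] by simp
    show "continuous_on UNIV (\<lambda>(t, s, x, z). C1 t s x z)"
      using bi by (simp add: bi_almost_automorphic_def)
    show "norm (C1 (t + \<tau>) (s + \<tau>) x z) \<le> lam1 t s"
      using bd[unfolded lambda_bounded_def, THEN conjunct2, rule_format, of "{(x, z)}"] by simp
    have "bounded {(x, z), (x', z')}" by simp
    with lip[unfolded kernel_lipschitz_def, THEN conjunct2, THEN conjunct2, rule_format, of "{(x, z), (x', z')}"]
    show "norm (C1 t s x z - C1 t s x' z') \<le> mu1 t s * (norm (x - x') + norm (z - z'))"
      by auto
    show "0 \<le> mu1 t s" using lip by (simp add: kernel_lipschitz_def)
    show "lam1 t integrable_on {..t}" using lam by (simp add: sup_integral_finite_def)
    show "mu1 t integrable_on {..t}" using mu by (simp add: sup_integral_finite_def)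
    show "integral {..t} (mu1 t) \<le> (SUP t. integral {..t} (mu1 t))"
      using mu by (intro cSUP_upper) (auto simp: sup_integral_finite_def)
    show "Lf + (SUP t. integral {..t} (mu1 t)) < 1" using assms(4,5) by simp
    show "continuous_on UNIV w1" using w1 by (simp add: almost_automorphic_def)
  qed (use assms(8) in \<open>auto simp: integral_equation_solution_def w0_def w1_def R\<close>)
  have B: "bounded B" by (simp add: B_def bounded_Times)
  show "almost_automorphic y"
    unfolding almost_automorphic_def
  proof (intro conjI allI assms(9) y_cont)
    fix \<sigma> :: "nat \<Rightarrow> real"
    \<comment> \<open>Successive refinement: first \<open>f\<close>, then the kernel, then
      \<open>w0\<close> and \<open>w1\<close>, each within the subsequence already found.\<close>
    obtain r1 F where r1: "strict_mono r1"
      and F: "\<And>t. uniform_limit B (\<lambda>n x. f (t + \<sigma> (r1 n)) x) (F t) sequentially"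
        "\<And>t. uniform_limit B (\<lambda>n x. F (t - \<sigma> (r1 n)) x) (f t) sequentially"
      using assms(2) B unfolding almost_automorphic_unif_def by meson
    obtain r2 D where r2: "strict_mono r2" and D: "limit_function_along C1 B (\<lambda>n. \<sigma> (r1 (r2 n))) D"
      using bi[unfolded bi_almost_automorphic_def, THEN conjunct2, rule_format, OF B, of "\<lambda>n. \<sigma> (r1 n)"] by auto
    obtain r3 v0 where r3: "strict_mono r3"
      and v0: "\<And>t. (\<lambda>n. w0 (t + \<sigma> (r1 (r2 (r3 n))))) \<longlonglongrightarrow> v0 t"
        "\<And>t. (\<lambda>n. v0 (t - \<sigma> (r1 (r2 (r3 n))))) \<longlonglongrightarrow> w0 t"
      using w0[unfolded almost_automorphic_def, THEN conjunct2, THEN conjunct2, rule_format, of "\<lambda>n. \<sigma> (r1 (r2 n))"]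
      by auto
    obtain r4 v1 where r4: "strict_mono r4"
      and v1: "\<And>t. (\<lambda>n. w1 (t + \<sigma> (r1 (r2 (r3 (r4 n)))))) \<longlonglongrightarrow> v1 t"
        "\<And>t. (\<lambda>n. v1 (t - \<sigma> (r1 (r2 (r3 (r4 n)))))) \<longlonglongrightarrow> w1 t"
      using w1[unfolded almost_automorphic_def, THEN conjunct2, THEN conjunct2, rule_format, of "\<lambda>n. \<sigma> (r1 (r2 (r3 n)))"]
      by auto
    \<comment> \<open>\<open>q2\<close>, \<open>q3\<close> and \<open>q4\<close> state that the
      indices chosen after \<open>r1\<close>, \<open>r2\<close> and \<open>r3\<close> tend to
      infinity; they carry the limits \<open>F\<close>, \<open>D\<close> and \<open>v0\<close> over
      to the final sequence.\<close>
    note q4 = filterlim_subseq[OF r4]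
    note q3 = filterlim_compose[OF filterlim_subseq[OF r3] q4]
    note q2 = filterlim_compose[OF filterlim_subseq[OF r2] q3]
    define r where "r = (\<lambda>n. r1 (r2 (r3 (r4 n))))"
    have D': "limit_function_along C1 B (\<lambda>n. \<sigma> (r n)) D"
      unfolding limit_function_along_def r_def
      by (intro conjI allI
          filterlim_compose[OF D[unfolded limit_function_along_def, THEN conjunct1, rule_format] q3]
          filterlim_compose[OF D[unfolded limit_function_along_def, THEN conjunct2, rule_format] q3])
    interpret integral_equation_limit f C1 lam1 mu1 Lf "SUP t. integral {..t} (mu1 t)" R y w0 w1
      "\<lambda>n. \<sigma> (r n)" F D v0 v1
    proof
      fix t
      show "uniform_limit B (\<lambda>n x. f (t + \<sigma> (r n)) x) (F t) sequentially"
        unfolding r_def by (rule filterlim_compose[OF F(1) q2])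
      show "uniform_limit B (\<lambda>n x. F (t - \<sigma> (r n)) x) (f t) sequentially"
        unfolding r_def by (rule filterlim_compose[OF F(2) q2])
      show "limit_function_along C1 B (\<lambda>n. \<sigma> (r n)) D" by fact
      show "(\<lambda>n. w0 (t + \<sigma> (r n))) \<longlonglongrightarrow> v0 t" "(\<lambda>n. v0 (t - \<sigma> (r n))) \<longlonglongrightarrow> w0 t"
        unfolding r_def by (rule filterlim_compose[OF v0(1) q4] filterlim_compose[OF v0(2) q4])+
      show "(\<lambda>n. w1 (t + \<sigma> (r n))) \<longlonglongrightarrow> v1 t" "(\<lambda>n. v1 (t - \<sigma> (r n))) \<longlonglongrightarrow> w1 t"
        unfolding r_def by (rule v1)+
    qed
    obtain v where v: "\<And>t. (\<lambda>n. y (t + \<sigma> (r n))) \<longlonglongrightarrow> v t"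
      using translates_convergent by blast
    have "norm (D t s x z - D t s x' z') \<le> mu1' t s * (norm (x - x') + norm (z - z'))"
      if "(x, z) \<in> B" "(x', z') \<in> B" for t s x z x' z'
      using lip[unfolded kernel_lipschitz_def, THEN conjunct2, THEN conjunct2, rule_format, OF B,
          THEN conjunct2, rule_format, OF D'] that by fastforce
    note vb = limit_translates_back[OF v this]
    have "strict_mono r" using r1 r2 r3 r4 by (simp add: r_def strict_mono_def)
    with v vb show "\<exists>r g. strict_mono r \<and> (\<forall>t. (\<lambda>n. y (t + \<sigma> (r n))) \<longlonglongrightarrow> g t) \<and>
        (\<forall>t. (\<lambda>n. g (t - \<sigma> (r n))) \<longlonglongrightarrow> y t)"
      by blast
  qed
qed

end
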